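(* Let $D>d$ be positive integers, let $\Lambda_{CG}:\mathcal{L}(\mathbb{C}^D)\to\mathcal{L}(\mathbb{C}^d)$ be a completely positive trace-preserving linear map, and let $V$ be a unitary on $\mathbb{C}^D\otimes\mathbb{C}^r\otimes\mathbb{C}^d$ (with $r\le d$) such that for all $\psi\in\mathcal{L}(\mathbb{C}^D)$ $$\Lambda_{CG}(\psi)=\mathrm{Tr}_{Dr}\big[V(\psi\otimes|0\rangle\langle 0|\otimes|0\rangle\langle 0|)V^\dagger\big].$$ Let $U_t$ be a unitary on $\mathbb{C}^D$ and let $\psi_0$ be a density operator on $\mathbb{C}^D$. Put $$\chi_0=V(\psi_0\otimes|0\rangle\langle 0|\otimes|0\rangle\langle 0|)V^\dagger,\quad \rho_0=\Lambda_{CG}(\psi_0)=\mathrm{Tr}_{Dr}(\chi_0),\quad \omega_0=\mathrm{Tr}_d(\chi_0),\quad W_t=V(U_t\otimes\mathbb{1}\otimes\mathbb{1})V^\dagger .$$ Let $\omega_0=\sum_j p_j|\phi_j\rangle\langle\phi_j|$ be a spectral decomposition, with $\{|\phi_j\rangle\}$ an orthonormal basis of $\mathbb{C}^D\otimes\mathbb{C}^r$, and set $M_{ij}=\sqrt{p_j}\,(\langle\phi_i|\otimes\mathbb{1}_d)W_t(|\phi_j\rangle\otimes\mathbb{1}_d)$. Write $\chi_0$ in the Bloch form $$\chi_0=\frac{1}{Drd}\Big(\mathbb{1}_{Dr}\otimes\mathbb{1}_d+\mathbb{1}_{Dr}\otimes\vec{\alpha}\cdot\vec{\sigma}_d+\vec{\beta}\cdot\vec{\sigma}_{Dr}\otimes\mathbb{1}_d+\sum_{i,j}\theta_{ij}\,\sigma_{Dr}^{(i)}\otimes\sigma_d^{(j)}\Big)$$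 with $\vec\alpha\in\mathbb{R}^{d^2-1}$, $\vec\beta\in\mathbb{R}^{(Dr)^2-1}$, $\theta_{ij}\in\mathbb{R}$, and set $\Theta_{ij}=(\theta_{ij}-\beta_i\alpha_j)/(Drd)$. Then the evolved effective state satisfies $$\Lambda_{CG}(U_t\psi_0U_t^\dagger)=\sum_{i,j}M_{ij}\rho_0M_{ij}^\dagger+\mathrm{Tr}_{Dr}\big(W_t(\chi_0-\omega_0\otimes\rho_0)W_t^\dagger\big)=\sum_{i,j}M_{ij}\rho_0M_{ij}^\dagger+\sum_{i,j}\Theta_{ij}\,\mathrm{Tr}_{Dr}\big(W_t(\sigma_{Dr}^{(i)}\otimes\sigma_d^{(j)})W_t^\dagger\big).$$ Moreover $\sum_{i,j}M_{ij}^\dagger M_{ij}=\mathbb{1}_d$, and $\mathrm{Tr}_d\big(\mathrm{Tr}_{Dr}(W_t(\sigma_{Dr}^{(i)}\otimes\sigma_d^{(j)})W_t^\dagger)\big)=0$ for all $i,j$.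
   Context: $\mathcal{L}(\mathcal{H})$ is the space of linear operators on a finite-dimensional complex Hilbert space $\mathcal{H}$. A density operator (state) is a positive semidefinite operator of trace $1$. A coarse graining map is a completely positive trace-preserving (CPTP) linear map $\Lambda_{CG}:\mathcal{L}(\mathbb{C}^D)\to\mathcal{L}(\mathbb{C}^d)$ with $D>d$. $|0\rangle$ denotes a fixed unit vector in $\mathbb{C}^r$ and in $\mathbb{C}^d$. On $\mathbb{C}^D\otimes\mathbb{C}^r\otimes\mathbb{C}^d$, $\mathrm{Tr}_{Dr}$ is the partial trace over the first two factors and $\mathrm{Tr}_d$ the partial trace over the last factor. For $q\ge 2$, $\vec\sigma_q=(\sigma_q^{(1)},\dots,\sigma_q^{(q^2-1)})$ is the list of $q\times q$ generalized Pauli matrices: a fixed basis of the real vector space of traceless Hermitian $q\times q$ matrices; $\vec{a}\cdot\vec\sigma_q=\sum_i a_i\sigma_q^{(i)}$. For $\sigma_{Dr}$, identify $\mathbb{C}^D\otimes\mathbb{C}^r\simeq\mathbb{C}^{Dr}$. The effective (coarse-grained) dynamics $\Gamma_t$ is defined at $\rho_0=\Lambda_{CG}(\psi_0)$ by the consistency requirement $\Gamma_t(\rho_0)=\Lambda_{CG}(U_t\psi_0U_t^\dagger)$. *)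

theory Defs
  imports "HOL-Analysis.Analysis"
begin

text \<open>
  \<open>\<complex>\<^sup>n\<close> is \<open>complex^'n\<close> with \<open>n = CARD('n)\<close>, and \<open>\<L>(\<complex>\<^sup>n)\<close> is the type of square matrices
  \<open>complex^'n^'n\<close>. The tensor product of \<open>complex^'a\<close> and \<open>complex^'b\<close> is \<open>complex^('a \<times> 'b)\<close>;
  its product index type also serves as the identification of \<open>\<complex>\<^sup>a \<otimes> \<complex>\<^sup>b\<close> with \<open>\<complex>\<^sup>a\<^sup>b\<close>.
\<close>

type_synonym 'n cmat = "((complex, 'n) vec, 'n) vec"

subsection \<open>Vectors and matrices\<close>

text \<open>The library's \<open>inner\<close> on \<open>complex^'n\<close> is only the real part of this one.\<close>

definition cinner :: "complex^'n \<Rightarrow> complex^'n \<Rightarrow> complex" where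
  "cinner u v = (\<Sum>i\<in>UNIV. cnj (u $ i) * v $ i)"

definition dagger :: "complex^'n^'m \<Rightarrow> complex^'m^'n" where
  "dagger A = (\<chi> i j. cnj (A $ j $ i))"

definition cscale :: "complex \<Rightarrow> complex^'n^'m \<Rightarrow> complex^'n^'m" where
  "cscale c A = (\<chi> i j. c * A $ i $ j)"

text \<open>\<open>ketbra u v\<close> is the operator \<open>|u\<rangle>\<langle>v|\<close>.\<close>

definition ketbra :: "complex^'m \<Rightarrow> complex^'n \<Rightarrow> complex^'n^'m" where
  "ketbra u v = (\<chi> i j. u $ i * cnj (v $ j))"

definition unitary :: "'n::finite cmat \<Rightarrow> bool" where
  "unitary U \<longleftrightarrow> dagger U ** U = mat 1 \<and> U ** dagger U = mat 1"

definition hermitian :: "'n::finite cmat \<Rightarrow> bool" where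
  "hermitian A \<longleftrightarrow> dagger A = A"

definition pos_semidef :: "'n::finite cmat \<Rightarrow> bool" where
  "pos_semidef A \<longleftrightarrow> (\<forall>v. cinner v (A *v v) \<in> \<real>\<^sub>\<ge>\<^sub>0)"

definition density_operator :: "'n::finite cmat \<Rightarrow> bool" where
  "density_operator A \<longleftrightarrow> pos_semidef A \<and> trace A = 1"

definition orthonormal_basis :: "('k \<Rightarrow> complex^'n::finite) \<Rightarrow> bool" where
  "orthonormal_basis \<phi> \<longleftrightarrow>
     (\<forall>i j. cinner (\<phi> i) (\<phi> j) = (if i = j then 1 else 0)) \<and> vec.span (range \<phi>) = UNIV"

subsection \<open>Tensor products and partial traces\<close>

definition tensor_vec :: "complex^'a::finite \<Rightarrow> complex^'b::finite \<Rightarrow> complex^('a \<times> 'b)" where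
  "tensor_vec u v = (\<chi> i. u $ fst i * v $ snd i)"

definition tensor :: "'a::finite cmat \<Rightarrow> 'b::finite cmat \<Rightarrow> ('a \<times> 'b) cmat"  (infixl \<open>\<otimes>\<close> 75) where
  "A \<otimes> B = (\<chi> i j. A $ fst i $ fst j * B $ snd i $ snd j)"

text \<open>
  \<open>ket_id u\<close> is \<open>|u\<rangle> \<otimes> \<one>\<close> as an operator from the second factor into the tensor product;
  its adjoint is \<open>\<langle>u| \<otimes> \<one>\<close>.
\<close>

definition ket_id :: "complex^'a::finite \<Rightarrow> complex^'b::finite^('a \<times> 'b)" where
  "ket_id u = matrix (tensor_vec u)"

text \<open>\<open>ptrace_fst\<close> traces out the first factor, \<open>ptrace_snd\<close> the second one.\<close>

definition ptrace_fst :: "('a::finite \<times> 'b::finite) cmat \<Rightarrow> 'b cmat" where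
  "ptrace_fst A = (\<chi> i j. \<Sum>k\<in>UNIV. A $ (k, i) $ (k, j))"

definition ptrace_snd :: "('a::finite \<times> 'b::finite) cmat \<Rightarrow> 'a cmat" where
  "ptrace_snd A = (\<chi> i j. \<Sum>k\<in>UNIV. A $ (i, k) $ (j, k))"

subsection \<open>Completely positive trace-preserving maps\<close>

lemma vector_space_cscale: "vector_space (cscale :: complex \<Rightarrow> complex^'n^'m \<Rightarrow> complex^'n^'m)"
  by unfold_locales (auto simp: cscale_def vec_eq_iff algebra_simps)

text \<open>
  The block matrix \<open>(X i j)\<close>, \<open>i, j < n\<close>, represents the element \<open>\<Sum>\<^sub>i\<^sub>j E\<^sub>i\<^sub>j \<otimes> X i j\<close> of
  \<open>\<L>(\<complex>\<^sup>n \<otimes> \<complex>\<^sup>a)\<close>, and the tuple \<open>(v i)\<close>, \<open>i < n\<close>, a vector of \<open>\<complex>\<^sup>n \<otimes> \<complex>\<^sup>a\<close>. The ampliation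
  of \<open>\<Lambda>\<close> by the identity on \<open>\<L>(\<complex>\<^sup>n)\<close> applies \<open>\<Lambda>\<close> to every block. Blocks are needed because
  \<open>n\<close> is quantified inside the definition.
\<close>

definition block_pos_semidef :: "nat \<Rightarrow> (nat \<Rightarrow> nat \<Rightarrow> 'a::finite cmat) \<Rightarrow> bool" where
  "block_pos_semidef n X \<longleftrightarrow>
     (\<forall>v :: nat \<Rightarrow> complex^'a. (\<Sum>i<n. \<Sum>j<n. cinner (v i) (X i j *v v j)) \<in> \<real>\<^sub>\<ge>\<^sub>0)"

definition completely_positive :: "('a::finite cmat \<Rightarrow> 'b::finite cmat) \<Rightarrow> bool" where
  "completely_positive \<Lambda> \<longleftrightarrow>
     (\<forall>n X. block_pos_semidef n X \<longrightarrow> block_pos_semidef n (\<lambda>i j. \<Lambda> (X i j)))"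

definition cptp :: "('a::finite cmat \<Rightarrow> 'b::finite cmat) \<Rightarrow> bool" where
  "cptp \<Lambda> \<longleftrightarrow> Vector_Spaces.linear cscale cscale \<Lambda> \<and> completely_positive \<Lambda> \<and>
     (\<forall>A. trace (\<Lambda> A) = trace A)"

subsection \<open>Generalized Pauli matrices\<close>

text \<open>For \<open>CARD('q) = 1\<close> the index set is empty.\<close>

definition pauli_index :: "'q itself \<Rightarrow> nat set" where
  "pauli_index _ = {1..CARD('q)\<^sup>2 - 1}"

text \<open>\<open>independent\<close> and \<open>span\<close> are the real-linear notions. Values of \<open>\<sigma>\<close> outside the index set are irrelevant.\<close>

definition generalized_pauli :: "(nat \<Rightarrow> 'q::finite cmat) \<Rightarrow> bool" where
  "generalized_pauli \<sigma> \<longleftrightarrow>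
     inj_on \<sigma> (pauli_index TYPE('q)) \<and>
     independent (\<sigma> ` pauli_index TYPE('q)) \<and>
     span (\<sigma> ` pauli_index TYPE('q)) = {A. hermitian A \<and> trace A = 0}"

definition pauli_sum :: "(nat \<Rightarrow> real) \<Rightarrow> (nat \<Rightarrow> 'q::finite cmat) \<Rightarrow> 'q cmat" where
  "pauli_sum a \<sigma> = (\<Sum>i\<in>pauli_index TYPE('q). a i *\<^sub>R \<sigma> i)"

end

theory Submission
  imports Defs
begin

text \<open>
  The intertwining relation \<open>W V = V (U \<otimes> \<one> \<otimes> \<one>)\<close> turns \<open>\<Lambda> (U \<psi>\<^sub>0 U\<^sup>\<dagger>)\<close> into \<open>Tr\<^sub>D\<^sub>r (W \<chi>\<^sub>0 W\<^sup>\<dagger>)\<close>. Splitting \<open>\<chi>\<^sub>0\<close> into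
  \<open>\<omega>\<^sub>0 \<otimes> \<rho>\<^sub>0\<close> and a remainder, the product part gives the Kraus form once \<open>Tr\<^sub>D\<^sub>r\<close> is computed in the
  eigenbasis of \<open>\<omega>\<^sub>0\<close>. The marginals of the Bloch form only see \<open>\<alpha>\<close> and \<open>\<beta>\<close>, because the Pauli
  matrices are traceless, so the remainder has coefficients \<open>\<theta>\<^sub>i\<^sub>j - \<beta>\<^sub>i \<alpha>\<^sub>j\<close>.
\<close>

subsection \<open>Matrix algebra\<close>

text \<open>Real linearity suffices, since all weights pulled out later (\<open>p j\<close>,
  \<open>\<theta> i j\<close>, \<open>\<Theta> i j\<close>) are real. Rectangular outer factors
  cover both conjugation by \<open>W\<close> and slicing by \<open>ket_id\<close>.\<close>

lemma linear_matrix_sandwich: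
  fixes X :: "complex^'b::finite^'a" and Y :: "complex^'e^'c::finite"
  shows "linear (\<lambda>A. X ** A ** Y)"
  by (rule linearI)
     (simp_all add: matrix_matrix_mult_def vec_eq_iff ring_distribs sum.distrib scaleR_sum_right
        sum_distrib_left sum_distrib_right)

lemma matrix_mult_scaleR:
  fixes A :: "complex^'b::finite^'a" and B :: "complex^'c^'b"
  shows "(x *\<^sub>R A) ** B = x *\<^sub>R (A ** B)" "A ** (x *\<^sub>R B) = x *\<^sub>R (A ** B)"
  by (simp_all add: matrix_matrix_mult_def vec_eq_iff scaleR_sum_right)

lemma cscale_1 [simp]: "cscale 1 A = A"
  by (simp add: cscale_def vec_eq_iff)

lemma dagger_dagger [simp]: "dagger (dagger A) = A"
  by (simp add: dagger_def vec_eq_iff)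

lemma dagger_scaleR: "dagger (x *\<^sub>R A) = x *\<^sub>R dagger A"
  by (simp add: dagger_def vec_eq_iff)

lemma dagger_mat_1 [simp]: "dagger (mat 1) = mat 1"
  by (auto simp: dagger_def mat_def vec_eq_iff)

lemma dagger_mult:
  fixes A :: "complex^'b::finite^'a" and B :: "complex^'c^'b"
  shows "dagger (A ** B) = dagger B ** dagger A"
  by (simp add: dagger_def matrix_matrix_mult_def vec_eq_iff mult.commute)

lemma cinner_mult_left:
  fixes A :: "complex^'b::finite^'a::finite"
  shows "cinner u (A *v v) = cinner (dagger A *v u) v"
  unfolding cinner_def dagger_def matrix_vector_mult_def
  by (simp add: sum_distrib_left sum_distrib_right, subst sum.swap, simp add: ac_simps)

lemma unitary_mult: "unitary A \<Longrightarrow> unitary B \<Longrightarrow> unitary (A ** B)"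
  unfolding unitary_def
  by (metis dagger_mult matrix_mul_assoc matrix_mul_rid)

lemma unitary_dagger: "unitary A \<Longrightarrow> unitary (dagger A)"
  by (simp add: unitary_def)

lemma trace_unitary_conj:
  assumes "unitary W"
  shows "trace (W ** A ** dagger W) = trace A"
proof -
  have "trace (W ** A ** dagger W) = trace (dagger W ** (W ** A))"
    by (rule trace_mul_sym)
  also have "\<dots> = trace A"
    using assms by (simp add: matrix_mul_assoc unitary_def)
  finally show ?thesis .
qed

lemma linear_trace: "linear (trace :: 'n::finite cmat \<Rightarrow> complex)"
  by (rule linearI) (simp_all add: trace_def sum.distrib scaleR_sum_right)

lemma trace_ketbra: "trace (ketbra u u) = cinner u u"
  by (simp add: trace_def ketbra_def cinner_def mult.commute)

lemma ketbra_mult_vec: "ketbra u v *v w = cinner v w *s u"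
  by (simp add: ketbra_def matrix_vector_mult_def cinner_def vec_eq_iff sum_distrib_left ac_simps)

lemma pos_semidef_conj:
  fixes A V :: "'n::finite cmat"
  assumes "pos_semidef A"
  shows "pos_semidef (V ** A ** dagger V)"
  using assms
  by (simp add: pos_semidef_def matrix_vector_mul_assoc [symmetric] cinner_mult_left [of _ V])

subsection \<open>Tensor products and partial traces\<close>

lemma linear_tensor_left: "linear (\<lambda>A. A \<otimes> B)"
  by (rule linearI) (simp_all add: tensor_def vec_eq_iff algebra_simps)

lemma linear_tensor_right: "linear (\<lambda>B. A \<otimes> B)"
  by (rule linearI) (simp_all add: tensor_def vec_eq_iff algebra_simps)

lemma tensor_mult: "(A \<otimes> B) ** (C \<otimes> E) = (A ** C) \<otimes> (B ** E)"
  by (simp add: tensor_def matrix_matrix_mult_def vec_eq_iff sum_product sum.cartesian_product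
      UNIV_Times_UNIV [symmetric] case_prod_beta ac_simps del: UNIV_Times_UNIV)

lemma dagger_tensor: "dagger (A \<otimes> B) = dagger A \<otimes> dagger B"
  by (simp add: tensor_def dagger_def vec_eq_iff)

lemma tensor_mat_1 [simp]: "mat 1 \<otimes> mat 1 = mat 1"
  by (auto simp: tensor_def mat_def vec_eq_iff)

lemma unitary_tensor: "unitary A \<Longrightarrow> unitary B \<Longrightarrow> unitary (A \<otimes> B)"
  by (simp add: unitary_def dagger_tensor tensor_mult)

lemma unitary_mat_1: "unitary (mat 1)"
  by (simp add: unitary_def)

text \<open>Entries of \<open>ket_id u\<close> and of \<open>tensor_vec u (axis k 1)\<close> vanish
  unless the second index component is the prescribed one, so sums over the product index collapse
  in this way.\<close>

lemma sum_prod_delta: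
  "(\<Sum>x\<in>(UNIV :: ('a::finite \<times> 'b::finite) set). if snd x = k then f x else 0) =
    (\<Sum>a\<in>UNIV. f (a, k))"
  by (simp add: UNIV_Times_UNIV [symmetric] sum.cartesian_product' del: UNIV_Times_UNIV)

lemma ket_id_nth: "ket_id u $ i $ j = (if snd i = j then u $ fst i else 0)"
  by (simp add: ket_id_def matrix_def tensor_vec_def axis_def)

lemma dagger_ket_id_sandwich_nth:
  "(dagger (ket_id u) ** A ** ket_id v) $ k $ l =
    (\<Sum>b\<in>UNIV. \<Sum>a\<in>UNIV. cnj (u $ a) * A $ (a, k) $ (b, l) * v $ b)"
  by (simp add: matrix_matrix_mult_def dagger_def ket_id_nth if_distrib [of cnj]
      if_distrib [of "\<lambda>x. x * _"] if_distrib [of "\<lambda>x. _ * x"] sum_prod_delta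
      sum_distrib_right cong: if_cong)

lemma linear_ptrace_fst: "linear ptrace_fst"
  by (rule linearI) (simp_all add: ptrace_fst_def vec_eq_iff sum.distrib scaleR_sum_right)

lemma linear_ptrace_snd: "linear ptrace_snd"
  by (rule linearI) (simp_all add: ptrace_snd_def vec_eq_iff sum.distrib scaleR_sum_right)

lemma ptrace_fst_tensor: "ptrace_fst (A \<otimes> B) = cscale (trace A) B"
  by (simp add: ptrace_fst_def tensor_def cscale_def trace_def vec_eq_iff sum_distrib_right)

lemma ptrace_snd_tensor: "ptrace_snd (A \<otimes> B) = cscale (trace B) A"
  by (simp add: ptrace_snd_def tensor_def cscale_def trace_def vec_eq_iff sum_distrib_left mult.commute)

lemma trace_ptrace_fst: "trace (ptrace_fst A) = trace A"
  by (simp add: ptrace_fst_def trace_def UNIV_Times_UNIV [symmetric] sum.cartesian_product'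
      del: UNIV_Times_UNIV) (rule sum.swap)

lemma trace_ptrace_snd: "trace (ptrace_snd A) = trace A"
  by (simp add: ptrace_snd_def trace_def UNIV_Times_UNIV [symmetric] sum.cartesian_product'
      del: UNIV_Times_UNIV)

lemma trace_tensor: "trace (A \<otimes> B) = trace A * trace B"
  by (simp add: tensor_def trace_def UNIV_Times_UNIV [symmetric] sum.cartesian_product' sum_product
      del: UNIV_Times_UNIV)

text \<open>Contracting the second factor of \<open>v\<close> with \<open>e\<close> reduces the
  quadratic form to that of \<open>A\<close>.\<close>

lemma pos_semidef_tensor_ketbra:
  fixes A :: "'a::finite cmat" and e :: "complex^'b::finite"
  assumes "pos_semidef A"
  shows "pos_semidef (A \<otimes> ketbra e e)"
  unfolding pos_semidef_def
proof
  fix v :: "complex^('a \<times> 'b)"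
  \<comment> \<open>This is the vector (1 (x) <e|) v.\<close>
  define w :: "complex^'a" where "w = (\<chi> i. \<Sum>k\<in>UNIV. cnj (e $ k) * v $ (i, k))"
  have "cinner v ((A \<otimes> ketbra e e) *v v) =
      (\<Sum>i\<in>UNIV. \<Sum>k\<in>UNIV. cnj (v $ (i, k)) *
        (\<Sum>j\<in>UNIV. \<Sum>l\<in>UNIV. A $ i $ j * (e $ k * cnj (e $ l)) * v $ (j, l)))"
    by (simp add: cinner_def tensor_def ketbra_def matrix_vector_mult_def
        UNIV_Times_UNIV [symmetric] sum.cartesian_product' del: UNIV_Times_UNIV)
  also have "\<dots> = (\<Sum>i\<in>UNIV. \<Sum>k\<in>UNIV. cnj (v $ (i, k)) * e $ k * (\<Sum>j\<in>UNIV. A $ i $ j * w $ j))"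
    by (simp add: w_def sum_distrib_left ac_simps)
  also have "\<dots> = cinner w (A *v w)"
    by (simp add: cinner_def matrix_vector_mult_def w_def sum_distrib_right ac_simps)
  finally show "cinner v ((A \<otimes> ketbra e e) *v v) \<in> \<real>\<^sub>\<ge>\<^sub>0"
    using assms by (simp add: pos_semidef_def)
qed

text \<open>The partial trace is the sum of the compressions to the standard basis vectors of the
  second factor. Its quadratic form is thus a sum of values of the form of \<open>A\<close>, which
  makes positivity pass to the marginal.\<close>

lemma cinner_ptrace_snd:
  fixes A :: "('a::finite \<times> 'b::finite) cmat"
  shows "cinner u (ptrace_snd A *v u) =
    (\<Sum>k\<in>UNIV. cinner (tensor_vec u (axis k 1)) (A *v tensor_vec u (axis k 1)))"
proof -
  have ket: "tensor_vec u (axis k 1) $ x = (if snd x = k then u $ fst x else 0)" for k x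
    by (simp add: tensor_vec_def axis_def)
  have "cinner (tensor_vec u (axis k 1)) (A *v tensor_vec u (axis k 1)) =
      (\<Sum>i\<in>UNIV. \<Sum>j\<in>UNIV. cnj (u $ i) * A $ (i, k) $ (j, k) * u $ j)" for k
    by (simp add: cinner_def matrix_vector_mult_def ket if_distrib [of cnj]
        if_distrib [of "\<lambda>x. x * _"] if_distrib [of "\<lambda>x. _ * x"] sum_prod_delta
        cong: if_cong) (simp add: sum_distrib_left mult.assoc)
  moreover have "cinner u (ptrace_snd A *v u) =
      (\<Sum>i\<in>UNIV. \<Sum>j\<in>UNIV. \<Sum>k\<in>UNIV. cnj (u $ i) * A $ (i, k) $ (j, k) * u $ j)"
    by (simp add: cinner_def ptrace_snd_def matrix_vector_mult_def sum_distrib_left sum_distrib_right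
        ac_simps)
  moreover have "\<dots> = (\<Sum>k\<in>UNIV. \<Sum>i\<in>UNIV. \<Sum>j\<in>UNIV. cnj (u $ i) * A $ (i, k) $ (j, k) * u $ j)"
    \<comment> \<open>Bringing \<open>k\<close> outermost takes two interchanges: past
      \<open>j\<close> inside the outer sum, then past \<open>i\<close>.\<close>
    by (rule trans [OF _ sum.swap], rule sum.cong [OF refl], rule sum.swap)
  ultimately show ?thesis by simp
qed

lemma sum_nonneg_Reals:
  "(\<And>k. k \<in> S \<Longrightarrow> f k \<in> \<real>\<^sub>\<ge>\<^sub>0) \<Longrightarrow> sum f S \<in> \<real>\<^sub>\<ge>\<^sub>0"
  by (induction S rule: infinite_finite_induct) (auto intro: nonneg_Reals_add_I)

lemma pos_semidef_ptrace_snd: "pos_semidef A \<Longrightarrow> pos_semidef (ptrace_snd A)"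
  unfolding pos_semidef_def cinner_ptrace_snd
  by (auto intro: sum_nonneg_Reals)

subsection \<open>Slicing by an orthonormal basis\<close>

text \<open>Factoring through the second space is what turns a product input into a sandwich of
  Kraus type.\<close>

lemma ketbra_tensor:
  "ketbra u u \<otimes> B = ket_id u ** B ** dagger (ket_id u)"
  by (simp add: vec_eq_iff matrix_matrix_mult_def ket_id_nth dagger_def tensor_def ketbra_def
      if_distrib if_distribR ac_simps cong: if_cong)

lemma dagger_ket_id_mult:
  "dagger (ket_id u) ** ket_id v = (cscale (cinner u v) (mat 1) :: 'b::finite cmat)"
proof -
  \<comment> \<open>The identity is inserted so that the entry formula for sandwiches
    applies.\<close>
  have "(dagger (ket_id u) ** mat 1 ** ket_id v) $ k $ l = cscale (cinner u v) (mat 1) $ k $ l" for k l :: 'b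
    unfolding dagger_ket_id_sandwich_nth
    by (auto simp: mat_def cscale_def cinner_def if_distrib [of "\<lambda>x. x * _"]
        if_distrib [of "\<lambda>x. _ * x"] cong: if_cong)
  then show ?thesis by (simp add: vec_eq_iff)
qed

text \<open>Let \<open>P\<close> have the \<phi> vectors as columns. Orthonormality is the equation
  P^* P = 1; as \<open>P\<close> is square, P P^* = 1 follows, and this is the completeness
  relation.\<close>

lemma sum_ketbra_orthonormal:
  fixes \<phi> :: "'n::finite \<Rightarrow> complex^'n"
  assumes "\<And>i j. cinner (\<phi> i) (\<phi> j) = (if i = j then 1 else 0)"
  shows "(\<Sum>i\<in>UNIV. ketbra (\<phi> i) (\<phi> i)) = mat 1"
proof -
  define P :: "'n cmat" where "P = (\<chi> a i. \<phi> i $ a)"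
  have "dagger P ** P = mat 1"
    using assms by (simp add: P_def dagger_def matrix_matrix_mult_def mat_def cinner_def vec_eq_iff)
  then have "P ** dagger P = mat 1"
    by (rule matrix_left_right_inverse [THEN iffD1])
  then show ?thesis
    by (simp add: P_def dagger_def matrix_matrix_mult_def vec_eq_iff ketbra_def)
qed

lemma sum_ket_id_orthonormal:
  fixes \<phi> :: "'n::finite \<Rightarrow> complex^'n"
  assumes "\<And>i j. cinner (\<phi> i) (\<phi> j) = (if i = j then 1 else 0)"
  shows "(\<Sum>i\<in>UNIV. ket_id (\<phi> i) ** dagger (ket_id (\<phi> i)) :: ('n \<times> 'b::finite) cmat) = mat 1"
proof -
  have "(\<Sum>i\<in>UNIV. ket_id (\<phi> i) ** dagger (ket_id (\<phi> i)) :: ('n \<times> 'b) cmat) =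
      (\<Sum>i\<in>UNIV. ketbra (\<phi> i) (\<phi> i)) \<otimes> mat 1"
    by (simp add: linear_sum [OF linear_tensor_left] ketbra_tensor)
  then show ?thesis
    using sum_ketbra_orthonormal [OF assms] by simp
qed

text \<open>The partial trace may be taken in any orthonormal basis: summing over the basis first
  leaves the completeness relation, which is a Kronecker delta in the two indices of the first
  factor.\<close>

lemma ptrace_fst_orthonormal:
  fixes \<phi> :: "'n::finite \<Rightarrow> complex^'n" and A :: "('n \<times> 'b::finite) cmat"
  assumes "\<And>i j. cinner (\<phi> i) (\<phi> j) = (if i = j then 1 else 0)"
  shows "ptrace_fst A = (\<Sum>i\<in>UNIV. dagger (ket_id (\<phi> i)) ** A ** ket_id (\<phi> i))"
proof -
  have res: "(\<Sum>i\<in>UNIV. \<phi> i $ a * cnj (\<phi> i $ b)) = (if a = b then 1 else 0)" for a b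
    using sum_ketbra_orthonormal [OF assms] by (simp add: vec_eq_iff ketbra_def mat_def)
  have "(\<Sum>i\<in>UNIV. dagger (ket_id (\<phi> i)) ** A ** ket_id (\<phi> i)) $ k $ l = ptrace_fst A $ k $ l" for k l
  proof -
    have "(\<Sum>i\<in>UNIV. dagger (ket_id (\<phi> i)) ** A ** ket_id (\<phi> i)) $ k $ l =
        (\<Sum>i\<in>UNIV. \<Sum>b\<in>UNIV. \<Sum>a\<in>UNIV. A $ (a, k) $ (b, l) * (\<phi> i $ b * cnj (\<phi> i $ a)))"
      by (simp add: dagger_ket_id_sandwich_nth ac_simps)
    also have "\<dots> = (\<Sum>b\<in>UNIV. \<Sum>a\<in>UNIV. A $ (a, k) $ (b, l) * (\<Sum>i\<in>UNIV. \<phi> i $ b * cnj (\<phi> i $ a)))"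
      by (simp only: sum_distrib_left, rule trans [OF sum.swap], rule sum.cong [OF refl], rule sum.swap)
    finally show ?thesis
      by (simp add: res ptrace_fst_def if_distrib [of "\<lambda>x. _ * x"] cong: if_cong)
  qed
  then show ?thesis by (simp add: vec_eq_iff)
qed

subsection \<open>Kraus form of a product input\<close>

text \<open>Each \<open>\<phi> k\<close> is an eigenvector with eigenvalue \<open>p k\<close>, so
  the quadratic form at this unit vector equals \<open>p k\<close>.\<close>

lemma spectral_nonneg:
  fixes \<phi> :: "'n::finite \<Rightarrow> complex^'n" and p :: "'n \<Rightarrow> real"
  assumes orth: "\<And>i j. cinner (\<phi> i) (\<phi> j) = (if i = j then 1 else 0)"
    and pos: "pos_semidef (\<Sum>j\<in>UNIV. p j *\<^sub>R ketbra (\<phi> j) (\<phi> j))"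
  shows "p k \<ge> 0"
proof -
  have "(\<Sum>j\<in>UNIV. p j *\<^sub>R ketbra (\<phi> j) (\<phi> j)) *v \<phi> k =
      (\<Sum>j\<in>UNIV. (p j *\<^sub>R ketbra (\<phi> j) (\<phi> j)) *v \<phi> k)"
    by (simp add: vec_eq_iff matrix_vector_mult_def sum_distrib_right) (auto intro: sum.swap)
  also have "\<dots> = (\<Sum>j\<in>UNIV. p j *\<^sub>R (ketbra (\<phi> j) (\<phi> j) *v \<phi> k))"
    by (simp add: vec_eq_iff matrix_vector_mult_def scaleR_sum_right)
  also have "\<dots> = (\<Sum>j\<in>UNIV. if j = k then p k *\<^sub>R \<phi> k else 0)"
    by (intro sum.cong refl)
       (auto simp: ketbra_mult_vec orth)
  finally have "(\<Sum>j\<in>UNIV. p j *\<^sub>R ketbra (\<phi> j) (\<phi> j)) *v \<phi> k = p k *\<^sub>R \<phi> k"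
    by simp
  moreover have "cinner (\<phi> k) (p k *\<^sub>R \<phi> k) = of_real (p k) * cinner (\<phi> k) (\<phi> k)"
    unfolding cinner_def by (simp add: sum_distrib_left) (simp add: scaleR_conv_of_real ac_simps)
  ultimately have "complex_of_real (p k) \<in> \<real>\<^sub>\<ge>\<^sub>0"
    using pos orth unfolding pos_semidef_def by (metis mult.right_neutral)
  then show ?thesis by simp
qed

text \<open>The operator \<open>M i j\<close> describes the environment starting in
  \<open>\<phi> j\<close> with weight \<open>p j\<close> and ending in \<open>\<phi> i\<close>.
  Since \<open>sqrt\<close> is an odd function on the reals, \<open>sqrt (p j)\<close> squares to
  the absolute value of \<open>p j\<close>; \<open>p_nonneg\<close> makes this \<open>p j\<close>
  itself.\<close>

locale kraus_family =
  fixes \<phi> :: "'n::finite \<Rightarrow> complex^'n" and p :: "'n \<Rightarrow> real"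
    and W :: "('n \<times> 'b::finite) cmat" and M :: "'n \<Rightarrow> 'n \<Rightarrow> 'b cmat"
  assumes orth: "\<And>i j. cinner (\<phi> i) (\<phi> j) = (if i = j then 1 else 0)"
    and p_nonneg: "\<And>j. p j \<ge> 0"
    and M: "\<And>i j. M i j = sqrt (p j) *\<^sub>R (dagger (ket_id (\<phi> i)) ** W ** ket_id (\<phi> j))"
begin

text \<open>The same basis serves twice: it diagonalizes the first tensor factor, giving the index
  \<open>j\<close>, and it evaluates the partial trace, giving the index \<open>i\<close>.\<close>

lemma ptrace_fst_product:
  "ptrace_fst (W ** ((\<Sum>j\<in>UNIV. p j *\<^sub>R ketbra (\<phi> j) (\<phi> j)) \<otimes> \<rho>) ** dagger W) =
    (\<Sum>i\<in>UNIV. \<Sum>j\<in>UNIV. M i j ** \<rho> ** dagger (M i j))"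
proof -
  have "W ** ((\<Sum>j\<in>UNIV. p j *\<^sub>R ketbra (\<phi> j) (\<phi> j)) \<otimes> \<rho>) ** dagger W =
      (\<Sum>j\<in>UNIV. p j *\<^sub>R (W ** (ket_id (\<phi> j) ** \<rho> ** dagger (ket_id (\<phi> j))) ** dagger W))"
    by (simp add: linear_sum [OF linear_tensor_left] linear_sum [OF linear_matrix_sandwich]
        linear_scale [OF linear_tensor_left] linear_scale [OF linear_matrix_sandwich] ketbra_tensor)
  moreover have "dagger (ket_id (\<phi> i)) **
        (p j *\<^sub>R (W ** (ket_id (\<phi> j) ** \<rho> ** dagger (ket_id (\<phi> j))) ** dagger W)) ** ket_id (\<phi> i) =
      M i j ** \<rho> ** dagger (M i j)" for i j
    using p_nonneg [of j]
    by (simp add: M dagger_mult dagger_scaleR matrix_mult_scaleR matrix_mul_assoc)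
  ultimately show ?thesis
    by (simp add: ptrace_fst_orthonormal [OF orth] linear_sum [OF linear_matrix_sandwich])
qed

text \<open>For fixed \<open>j\<close>, the sum over \<open>i\<close> is a resolution of the
  identity between \<open>dagger W\<close> and \<open>W\<close>. Unitarity and the normalization of
  \<open>\<phi> j\<close> leave \<open>p j\<close> times the identity, and the weights add up to
  one.\<close>

lemma sum_dagger_mult:
  assumes "unitary W" and "(\<Sum>j\<in>UNIV. p j) = 1"
  shows "(\<Sum>i\<in>UNIV. \<Sum>j\<in>UNIV. dagger (M i j) ** M i j) = mat 1"
proof -
  have "(\<Sum>i\<in>UNIV. dagger (M i j) ** M i j) = p j *\<^sub>R mat 1" for j
  proof -
    let ?X = "dagger (ket_id (\<phi> j)) ** dagger W" and ?Y = "W ** ket_id (\<phi> j)"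
    have "(\<Sum>i\<in>UNIV. dagger (M i j) ** M i j) =
        (\<Sum>i\<in>UNIV. p j *\<^sub>R (?X ** (ket_id (\<phi> i) ** dagger (ket_id (\<phi> i))) ** ?Y))"
      using p_nonneg [of j]
      by (simp add: M dagger_mult dagger_scaleR matrix_mult_scaleR matrix_mul_assoc)
    also have "\<dots> = p j *\<^sub>R (?X ** (\<Sum>i\<in>UNIV. ket_id (\<phi> i) ** dagger (ket_id (\<phi> i))) ** ?Y)"
      by (simp only: linear_sum [OF linear_matrix_sandwich] scaleR_sum_right)
    also have "\<dots> = p j *\<^sub>R (dagger (ket_id (\<phi> j)) ** (dagger W ** W) ** ket_id (\<phi> j))"
      by (simp add: sum_ket_id_orthonormal [OF orth] matrix_mul_assoc)
    also have "\<dots> = p j *\<^sub>R mat 1"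
      using assms(1) by (simp add: unitary_def dagger_ket_id_mult orth)
    finally show ?thesis .
  qed
  then have "(\<Sum>j\<in>UNIV. \<Sum>i\<in>UNIV. dagger (M i j) ** M i j) = (\<Sum>j\<in>UNIV. p j) *\<^sub>R mat 1"
    by (simp only: scaleR_left.sum)
  then show ?thesis
    using assms(2) by (subst sum.swap) simp
qed

end

subsection \<open>Bloch form\<close>

lemma trace_pauli:
  fixes \<sigma> :: "nat \<Rightarrow> 'q::finite cmat"
  assumes "generalized_pauli \<sigma>" "i \<in> pauli_index TYPE('q)"
  shows "trace (\<sigma> i) = 0"
  using assms span_base [of "\<sigma> i" "\<sigma> ` pauli_index TYPE('q)"]
  by (auto simp: generalized_pauli_def)

lemma trace_pauli_sum:
  fixes \<sigma> :: "nat \<Rightarrow> 'q::finite cmat"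
  assumes "generalized_pauli \<sigma>"
  shows "trace (pauli_sum a \<sigma>) = 0"
  unfolding pauli_sum_def
  by (simp add: linear_sum [OF linear_trace] linear_scale [OF linear_trace] trace_pauli [OF assms])

text \<open>The coefficients \<open>b i * a j\<close> are those that the product of the marginals
  contributes to the correlation term.\<close>

lemma tensor_pauli_sum:
  fixes \<sigma> :: "nat \<Rightarrow> 'm::finite cmat" and \<tau> :: "nat \<Rightarrow> 'n::finite cmat"
  shows "pauli_sum b \<sigma> \<otimes> pauli_sum a \<tau> =
    (\<Sum>i\<in>pauli_index TYPE('m). \<Sum>j\<in>pauli_index TYPE('n). (b i * a j) *\<^sub>R (\<sigma> i \<otimes> \<tau> j))"
  unfolding pauli_sum_def
  by (simp add: linear_sum [OF linear_tensor_left] linear_scale [OF linear_tensor_left])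
     (simp add: linear_sum [OF linear_tensor_right] linear_scale [OF linear_tensor_right]
      scaleR_sum_right)

text \<open>The product of the marginals reproduces the identity term and both local terms of
  \<open>X\<close>, so the difference is supported on the correlation terms alone.\<close>

lemma bloch_correlation:
  fixes \<sigma> :: "nat \<Rightarrow> 'm::finite cmat" and \<tau> :: "nat \<Rightarrow> 'n::finite cmat"
  assumes \<sigma>: "generalized_pauli \<sigma>" and \<tau>: "generalized_pauli \<tau>"
    and bloch: "X = (1 / real (CARD('m) * CARD('n))) *\<^sub>R
       (mat 1 \<otimes> mat 1 + mat 1 \<otimes> pauli_sum a \<tau> + pauli_sum b \<sigma> \<otimes> mat 1
        + (\<Sum>i\<in>pauli_index TYPE('m). \<Sum>j\<in>pauli_index TYPE('n). \<theta> i j *\<^sub>R (\<sigma> i \<otimes> \<tau> j)))"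
  shows "X - ptrace_snd X \<otimes> ptrace_fst X =
    (\<Sum>i\<in>pauli_index TYPE('m). \<Sum>j\<in>pauli_index TYPE('n).
       ((\<theta> i j - b i * a j) / real (CARD('m) * CARD('n))) *\<^sub>R (\<sigma> i \<otimes> \<tau> j))"
proof -
  let ?N = "real (CARD('m) * CARD('n))"
  let ?T = "\<Sum>i\<in>pauli_index TYPE('m). \<Sum>j\<in>pauli_index TYPE('n). \<theta> i j *\<^sub>R (\<sigma> i \<otimes> \<tau> j)"
  \<comment> \<open>Partial traces of products produce complex scalars; these rules bring them back
    to the real scaling of the Bloch form.\<close>
  have cscale: "cscale (of_nat n) A = real n *\<^sub>R A" "cscale 0 A = 0" for n and A :: "complex^'x^'y"
    by (simp_all add: cscale_def vec_eq_iff) (simp add: scaleR_conv_of_real)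
  have tr1: "trace (mat 1 :: 'q::finite cmat) = of_nat CARD('q)"
    by (simp add: trace_def mat_def)
  have T: "ptrace_fst ?T = 0" "ptrace_snd ?T = 0"
    by (simp_all add: linear_sum [OF linear_ptrace_fst] linear_scale [OF linear_ptrace_fst]
        linear_sum [OF linear_ptrace_snd] linear_scale [OF linear_ptrace_snd]
        ptrace_fst_tensor ptrace_snd_tensor trace_pauli [OF \<sigma>] trace_pauli [OF \<tau>] cscale)
  \<comment> \<open>Tracing out the first factor multiplies the surviving terms by its dimension,
    which cancels one factor of the normalization.\<close>
  have fst: "ptrace_fst X = (1 / real CARD('n)) *\<^sub>R (mat 1 + pauli_sum a \<tau>)"
    unfolding bloch linear_scale [OF linear_ptrace_fst] linear_add [OF linear_ptrace_fst] T
      ptrace_fst_tensor trace_pauli_sum [OF \<sigma>] tr1 cscale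
    by (simp add: scaleR_add_right)
  have snd: "ptrace_snd X = (1 / real CARD('m)) *\<^sub>R (mat 1 + pauli_sum b \<sigma>)"
    unfolding bloch linear_scale [OF linear_ptrace_snd] linear_add [OF linear_ptrace_snd] T
      ptrace_snd_tensor trace_pauli_sum [OF \<tau>] tr1 cscale
    by (simp add: scaleR_add_right)
  have "ptrace_snd X \<otimes> ptrace_fst X = (1 / ?N) *\<^sub>R
      (mat 1 \<otimes> mat 1 + mat 1 \<otimes> pauli_sum a \<tau> + pauli_sum b \<sigma> \<otimes> mat 1
        + pauli_sum b \<sigma> \<otimes> pauli_sum a \<tau>)"
    unfolding fst snd linear_scale [OF linear_tensor_left] linear_scale [OF linear_tensor_right]
      linear_add [OF linear_tensor_left] linear_add [OF linear_tensor_right]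
    by (simp add: algebra_simps)
  then have "X - ptrace_snd X \<otimes> ptrace_fst X = (1 / ?N) *\<^sub>R (?T - pauli_sum b \<sigma> \<otimes> pauli_sum a \<tau>)"
    unfolding bloch by (simp add: scaleR_diff_right [symmetric])
  then show ?thesis
    by (simp add: tensor_pauli_sum sum_subtractf [symmetric] scaleR_diff_left [symmetric] scaleR_sum_right)
qed

section \<open>Evolution of the effective state\<close>

theorem mainTheorem1:
  fixes \<Lambda> :: "'D::finite cmat \<Rightarrow> 'd::finite cmat"
    and V W :: "(('D \<times> 'r::finite) \<times> 'd) cmat"
    and e\<^sub>r :: "complex^'r" and e\<^sub>d :: "complex^'d"
    and U \<psi>\<^sub>0 :: "'D cmat"
    and \<chi>\<^sub>0 :: "(('D \<times> 'r) \<times> 'd) cmat"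
    and \<rho>\<^sub>0 :: "'d cmat" and \<omega>\<^sub>0 :: "('D \<times> 'r) cmat"
    and p :: "'D \<times> 'r \<Rightarrow> real" and \<phi> :: "'D \<times> 'r \<Rightarrow> complex^('D \<times> 'r)"
    and M :: "'D \<times> 'r \<Rightarrow> 'D \<times> 'r \<Rightarrow> 'd cmat"
    and \<sigma>Dr :: "nat \<Rightarrow> ('D \<times> 'r) cmat" and \<sigma>d :: "nat \<Rightarrow> 'd cmat"
    and \<alpha> \<beta> :: "nat \<Rightarrow> real" and \<theta> \<Theta> :: "nat \<Rightarrow> nat \<Rightarrow> real"
  assumes "CARD('D) > CARD('d)" and "CARD('r) \<le> CARD('d)"
    and "cptp \<Lambda>"
    and "unitary V"
    and "norm e\<^sub>r = 1" and "norm e\<^sub>d = 1"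
    and "\<forall>\<psi>. \<Lambda> \<psi> = ptrace_fst (V ** (\<psi> \<otimes> ketbra e\<^sub>r e\<^sub>r \<otimes> ketbra e\<^sub>d e\<^sub>d) ** dagger V)"
    and "unitary U"
    and "density_operator \<psi>\<^sub>0"
    and "\<chi>\<^sub>0 = V ** (\<psi>\<^sub>0 \<otimes> ketbra e\<^sub>r e\<^sub>r \<otimes> ketbra e\<^sub>d e\<^sub>d) ** dagger V"
    and "\<rho>\<^sub>0 = \<Lambda> \<psi>\<^sub>0"
    and "\<omega>\<^sub>0 = ptrace_snd \<chi>\<^sub>0"
    and "W = V ** (U \<otimes> mat 1 \<otimes> mat 1) ** dagger V"
    and "orthonormal_basis \<phi>"
    and "\<omega>\<^sub>0 = (\<Sum>j\<in>UNIV. p j *\<^sub>R ketbra (\<phi> j) (\<phi> j))"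
    and "\<forall>i j. M i j = sqrt (p j) *\<^sub>R (dagger (ket_id (\<phi> i)) ** W ** ket_id (\<phi> j))"
    and "generalized_pauli \<sigma>Dr" and "generalized_pauli \<sigma>d"
    and "\<chi>\<^sub>0 = (1 / real (CARD('D) * CARD('r) * CARD('d))) *\<^sub>R
           (mat 1 \<otimes> mat 1 + mat 1 \<otimes> pauli_sum \<alpha> \<sigma>d + pauli_sum \<beta> \<sigma>Dr \<otimes> mat 1
            + (\<Sum>i\<in>pauli_index TYPE('D \<times> 'r). \<Sum>j\<in>pauli_index TYPE('d).
                 \<theta> i j *\<^sub>R (\<sigma>Dr i \<otimes> \<sigma>d j)))"
    and "\<forall>i\<in>pauli_index TYPE('D \<times> 'r). \<forall>j\<in>pauli_index TYPE('d).
           \<Theta> i j = (\<theta> i j - \<beta> i * \<alpha> j) / real (CARD('D) * CARD('r) * CARD('d))"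
  shows "(\<Lambda> (U ** \<psi>\<^sub>0 ** dagger U) =
           (\<Sum>i\<in>UNIV. \<Sum>j\<in>UNIV. M i j ** \<rho>\<^sub>0 ** dagger (M i j))
           + ptrace_fst (W ** (\<chi>\<^sub>0 - \<omega>\<^sub>0 \<otimes> \<rho>\<^sub>0) ** dagger W)) \<and>
         ((\<Sum>i\<in>UNIV. \<Sum>j\<in>UNIV. M i j ** \<rho>\<^sub>0 ** dagger (M i j))
           + ptrace_fst (W ** (\<chi>\<^sub>0 - \<omega>\<^sub>0 \<otimes> \<rho>\<^sub>0) ** dagger W) =
         (\<Sum>i\<in>UNIV. \<Sum>j\<in>UNIV. M i j ** \<rho>\<^sub>0 ** dagger (M i j))
           + (\<Sum>i\<in>pauli_index TYPE('D \<times> 'r). \<Sum>j\<in>pauli_index TYPE('d).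
                \<Theta> i j *\<^sub>R ptrace_fst (W ** (\<sigma>Dr i \<otimes> \<sigma>d j) ** dagger W))) \<and>
         ((\<Sum>i\<in>UNIV. \<Sum>j\<in>UNIV. dagger (M i j) ** M i j) = mat 1) \<and>
         (\<forall>i\<in>pauli_index TYPE('D \<times> 'r). \<forall>j\<in>pauli_index TYPE('d).
           trace (ptrace_fst (W ** (\<sigma>Dr i \<otimes> \<sigma>d j) ** dagger W)) = 0)"
proof -
  note V = \<open>unitary V\<close> and \<Lambda> = assms(7) and \<chi>\<^sub>0 = assms(10) and \<omega>\<^sub>0 = assms(12) and W = assms(13)
  let ?E = "ketbra e\<^sub>r e\<^sub>r" and ?F = "ketbra e\<^sub>d e\<^sub>d"
  let ?U = "U \<otimes> mat 1 \<otimes> mat 1 :: (('D \<times> 'r) \<times> 'd) cmat"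
  have unitary_W: "unitary W"
    unfolding W
    by (intro unitary_mult unitary_tensor unitary_dagger unitary_mat_1 V \<open>unitary U\<close>)
  have \<rho>\<^sub>0: "\<rho>\<^sub>0 = ptrace_fst \<chi>\<^sub>0"
    using assms(11) \<Lambda> \<chi>\<^sub>0 by simp
  have orth: "cinner (\<phi> i) (\<phi> j) = (if i = j then 1 else 0)" for i j
    using \<open>orthonormal_basis \<phi>\<close> unfolding orthonormal_basis_def by blast
  \<comment> \<open>Tensoring with rank-one projectors, conjugation by \<open>V\<close> and the
    partial trace each preserve the positivity of the initial state.\<close>
  have "pos_semidef \<omega>\<^sub>0"
    unfolding \<omega>\<^sub>0 \<chi>\<^sub>0
    using \<open>density_operator \<psi>\<^sub>0\<close>
    by (intro pos_semidef_ptrace_snd pos_semidef_conj pos_semidef_tensor_ketbra)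
       (simp add: density_operator_def)
  then have p_nonneg: "p j \<ge> 0" for j
    using spectral_nonneg [OF orth] assms(15) by simp
  interpret kraus_family \<phi> p W M
    using orth p_nonneg assms(16) by unfold_locales auto

  \<comment> \<open>Both marginals have the trace of the joint state, so trace preservation of
    \<open>\<Lambda>\<close> normalizes the weights.\<close>
  have "complex_of_real (\<Sum>j\<in>UNIV. p j) = trace \<omega>\<^sub>0"
    by (simp add: assms(15) linear_sum [OF linear_trace] linear_scale [OF linear_trace] trace_ketbra
        orth) (simp add: scaleR_conv_of_real)
  also have "\<dots> = trace (\<Lambda> \<psi>\<^sub>0)"
    using \<rho>\<^sub>0 assms(11) by (simp add: \<omega>\<^sub>0 trace_ptrace_snd trace_ptrace_fst)
  also have "\<dots> = 1"
    using \<open>cptp \<Lambda>\<close> \<open>density_operator \<psi>\<^sub>0\<close> by (simp add: cptp_def density_operator_def)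
  finally have sum_p: "(\<Sum>j\<in>UNIV. p j) = 1"
    by (metis of_real_eq_1_iff)

  \<comment> \<open>The grouping exposes the two products \<open>dagger V ** V\<close> that cancel,
    leaving \<open>V\<close> applied to the evolved initial state with untouched ancillas.\<close>
  have "W ** \<chi>\<^sub>0 ** dagger W =
      V ** ?U ** (dagger V ** V) ** (\<psi>\<^sub>0 \<otimes> ?E \<otimes> ?F) ** (dagger V ** V) ** dagger ?U ** dagger V"
    by (simp only: W \<chi>\<^sub>0 dagger_mult dagger_dagger matrix_mul_assoc)
  also have "\<dots> = V ** (?U ** (\<psi>\<^sub>0 \<otimes> ?E \<otimes> ?F) ** dagger ?U) ** dagger V"
    using V by (simp add: unitary_def matrix_mul_assoc)
  also have "?U ** (\<psi>\<^sub>0 \<otimes> ?E \<otimes> ?F) ** dagger ?U = (U ** \<psi>\<^sub>0 ** dagger U) \<otimes> ?E \<otimes> ?F"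
    by (simp add: dagger_tensor tensor_mult)
  finally have evolved: "\<Lambda> (U ** \<psi>\<^sub>0 ** dagger U) = ptrace_fst (W ** \<chi>\<^sub>0 ** dagger W)"
    using \<Lambda> by simp

  have "\<chi>\<^sub>0 - \<omega>\<^sub>0 \<otimes> \<rho>\<^sub>0 = (\<Sum>i\<in>pauli_index TYPE('D \<times> 'r). \<Sum>j\<in>pauli_index TYPE('d).
      ((\<theta> i j - \<beta> i * \<alpha> j) / real (CARD('D \<times> 'r) * CARD('d))) *\<^sub>R (\<sigma>Dr i \<otimes> \<sigma>d j))"
    unfolding \<omega>\<^sub>0 \<rho>\<^sub>0
    by (rule bloch_correlation [OF assms(17,18)]) (use assms(19) in \<open>simp add: card_prod\<close>)
  also have "\<dots> = (\<Sum>i\<in>pauli_index TYPE('D \<times> 'r). \<Sum>j\<in>pauli_index TYPE('d).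
      \<Theta> i j *\<^sub>R (\<sigma>Dr i \<otimes> \<sigma>d j))"
    using assms(20) by (intro sum.cong refl) simp
  finally have correlation: "\<chi>\<^sub>0 - \<omega>\<^sub>0 \<otimes> \<rho>\<^sub>0 = \<dots>" .

  \<comment> \<open>The product state is added and subtracted inside the linear map; its part is
    then rewritten in Kraus form.\<close>
  have "\<Lambda> (U ** \<psi>\<^sub>0 ** dagger U) = ptrace_fst (W ** (\<omega>\<^sub>0 \<otimes> \<rho>\<^sub>0) ** dagger W)
      + ptrace_fst (W ** (\<chi>\<^sub>0 - \<omega>\<^sub>0 \<otimes> \<rho>\<^sub>0) ** dagger W)"
    by (simp add: evolved linear_diff [OF linear_matrix_sandwich] linear_diff [OF linear_ptrace_fst])
  also have "ptrace_fst (W ** (\<omega>\<^sub>0 \<otimes> \<rho>\<^sub>0) ** dagger W) =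
      (\<Sum>i\<in>UNIV. \<Sum>j\<in>UNIV. M i j ** \<rho>\<^sub>0 ** dagger (M i j))"
    unfolding assms(15) by (rule ptrace_fst_product)
  finally have split: "\<Lambda> (U ** \<psi>\<^sub>0 ** dagger U) =
      (\<Sum>i\<in>UNIV. \<Sum>j\<in>UNIV. M i j ** \<rho>\<^sub>0 ** dagger (M i j))
      + ptrace_fst (W ** (\<chi>\<^sub>0 - \<omega>\<^sub>0 \<otimes> \<rho>\<^sub>0) ** dagger W)" .
  have remainder: "ptrace_fst (W ** (\<chi>\<^sub>0 - \<omega>\<^sub>0 \<otimes> \<rho>\<^sub>0) ** dagger W) =
      (\<Sum>i\<in>pauli_index TYPE('D \<times> 'r). \<Sum>j\<in>pauli_index TYPE('d).
         \<Theta> i j *\<^sub>R ptrace_fst (W ** (\<sigma>Dr i \<otimes> \<sigma>d j) ** dagger W))"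
    unfolding correlation linear_sum [OF linear_matrix_sandwich] linear_scale [OF linear_matrix_sandwich]
      linear_sum [OF linear_ptrace_fst] linear_scale [OF linear_ptrace_fst] ..
  \<comment> \<open>The total trace is invariant under conjugation by \<open>W\<close> and
    factorizes on the tensor product, where the factor from \<open>\<sigma>Dr i\<close>
    vanishes.\<close>
  have traceless: "trace (ptrace_fst (W ** (\<sigma>Dr i \<otimes> \<sigma>d j) ** dagger W)) = 0"
    if "i \<in> pauli_index TYPE('D \<times> 'r)" for i j
    using that
    by (simp add: trace_ptrace_fst trace_unitary_conj [OF unitary_W] trace_tensor
        trace_pauli [OF assms(17)])
  show ?thesis
    using split remainder sum_dagger_mult [OF unitary_W sum_p] traceless by simp
qed

end
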